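(* Let $F$ be an algebraically closed field of characteristic $0$, and let $L$ be an $(n+1)$-dimensional alternating $n$-ary algebra over $F$ (not necessarily satisfying the generalized Jacobi identity) with ordered basis $e_1,\dots,e_{n+1}$. Let $X=\{x_1,\dots,x_{n+1}\}$, and let $y_i$ and $G_i$ ($1\le i\le n+1$) be the elements of the free associative algebra $F\langle X\rangle$ defined in the context. Then the normal form modulo $\{G_1,\dots,G_{n+1}\}$ of the composition $G_1x_1-x_{n+1}G_{n+1}$ is $$N=(-1)^n\sum_{i=1}^{n+1}(-1)^i\big(x_iG_i-(-1)^nG_ix_i\big)=(-1)^{n+1}\sum_{i=1}^{n+1}(-1)^i\big(x_iy_i-(-1)^ny_ix_i\big).$$
   Context: An alternating $n$-ary algebra is a vector space $L$ with a multilinear operation $[z_1,\dots,z_n]$ satisfying $[z_1,\dots,z_n]=\epsilon(\sigma)[z_{\sigma(1)},\dots,z_{\sigma(n)}]$ for all $\sigma\in S_n$, where $\epsilon$ is the sign. The generalized Jacobi identity is $[[z_1,\dots,z_n],w_2,\dots,w_n]=\sum_{i=1}^n[z_1,\dots,[z_i,w_2,\dots,w_n],\dots,z_n]$. $F\langle X\rangle$ is the free unital associative algebra on $X$, with basis the free monoid $X^*$ of words. Let $\phi\colon L\to F\langle X\rangle$ be the linear map with $\phi(e_i)=x_i$, and let $y_i=\phi([e_1,\dots,\widehat{e}_i,\dots,e_{n+1}])$ ($\widehat{e}_i$ means $e_i$ is omitted). For elements $z_1,\dots,z_n$ of an associative algebra, $\mathrm{alt}(z_1,\dots,z_n)=\sum_{\sigma\in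 S_n}\epsilon(\sigma)z_{\sigma(1)}\cdots z_{\sigma(n)}$. Define $$G_i=(-1)^{\lfloor n/2\rfloor}\big(\mathrm{alt}(x_1,\dots,\widehat{x}_i,\dots,x_{n+1})-y_i\big)\quad(1\le i\le n+1).$$ Words are ordered by the degree-lexicographical order: $u<v$ iff $\deg u<\deg v$, or $\deg u=\deg v$ and at the first position where they differ $u$ has $x_i$ and $v$ has $x_j$ with $i<j$. $\mathrm{LM}(f)$ is the largest word occurring with nonzero coefficient in $f$; here $\mathrm{LM}(G_i)=x_{n+1}\cdots\widehat{x}_i\cdots x_1$, with coefficient $1$. A word $u$ is a factor of $v$ if $v=w_1uw_2$ for some words $w_1,w_2$. A polynomial is in normal form modulo a set $G$ of monic polynomials if no word occurring in it has a factor $\mathrm{LM}(g)$, $g\in G$. A normal form of $f$ modulo $G$ is a polynomial in normal form modulo $G$ obtained from $f$ by finitely many reduction steps, each step replacing the current polynomial $h$ by $h-c\,w_1gw_2$, where $g\in G$, $w_1,w_2\in X^*$, and $c\neq0$ is the coefficient in $h$ of the word $w_1\mathrm{LM}(g)w_2$.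
   Formalization: The last expression gets the missing factor (-1)^{floor(n/2)} (the printed equality fails for n=3, [e_2,e_3,e_4]=e_1); n>=2 is assumed; for n=2, where N need not be in normal form ([e_2,e_3]=e_2), only that the composition reduces to N is claimed. *)

theory Defs
  imports
    "HOL-Library.Poly_Mapping"
    "HOL-Library.Sublist"
    "HOL-Combinatorics.Permutations"
    "HOL-Computational_Algebra.Polynomial"
begin

text \<open>
  With the free monoid structure on lists (unit \<open>[]\<close>, product \<open>@\<close>), the type
  \<open>nat list \<Rightarrow>\<^sub>0 'a\<close> with the convolution product of
  \<open>HOL-Library.Poly_Mapping\<close> is the free unital associative algebra on letters indexed by
  \<open>nat\<close>. The free algebra on \<open>X = {x\<^sub>1, \<dots>, x\<^sub>m}\<close> is its
  subalgebra of elements supported on \<open>lists {1..m}\<close>.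
\<close>

instantiation list :: (type) monoid_add
begin

definition zero_list :: "'a list" where "zero_list = []"

definition plus_list :: "'a list \<Rightarrow> 'a list \<Rightarrow> 'a list" where "plus_list u v = u @ v"

instance by standard (simp_all add: zero_list_def plus_list_def)

end

type_synonym 'a free_algebra = "nat list \<Rightarrow>\<^sub>0 'a"

definition word :: "nat list \<Rightarrow> 'a::field free_algebra" where
  "word w = Poly_Mapping.single w 1"

definition gen :: "nat \<Rightarrow> 'a::field free_algebra" where
  "gen i = word [i]"

definition fscale :: "'a::field \<Rightarrow> 'a free_algebra \<Rightarrow> 'a free_algebra" where
  "fscale c f = Poly_Mapping.map ((*) c) f"

lemma lookup_fscale: "Poly_Mapping.lookup (fscale c f) w = c * Poly_Mapping.lookup f w"
  by (simp add: fscale_def Poly_Mapping.map.rep_eq when_def)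

lemma vector_space_fscale: "vector_space fscale"
  by unfold_locales (auto intro!: poly_mapping_eqI simp: lookup_fscale lookup_add algebra_simps)

locale alternating_algebra = vector_space scale
  for scale :: "'a::field \<Rightarrow> 'v::ab_group_add \<Rightarrow> 'v" +
  fixes n :: nat and br :: "'v list \<Rightarrow> 'v"
  assumes multilinear: "\<And>zs i. length zs = n \<Longrightarrow> i < n \<Longrightarrow>
      Vector_Spaces.linear scale scale (\<lambda>z. br (zs[i := z]))"
    and alternating: "\<And>zs \<sigma>. length zs = n \<Longrightarrow> \<sigma> permutes {..<n} \<Longrightarrow>
      br zs = scale (of_int (sign \<sigma>)) (br (permute_list \<sigma> zs))"

text \<open>Positions in lists count from 0, letters and basis vectors from 1.\<close>

text \<open>The list \<open>f 1, \<dots>, f (n + 1)\<close> with the entry \<open>f i\<close> omitted.\<close>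

definition omit :: "nat \<Rightarrow> (nat \<Rightarrow> 'b) \<Rightarrow> nat \<Rightarrow> 'b list" where
  "omit n f i = map f (filter (\<lambda>j. j \<noteq> i) [1..<n + 2])"

definition alt :: "'r::ring_1 list \<Rightarrow> 'r" where
  "alt zs = (\<Sum>\<sigma> | \<sigma> permutes {..<length zs}.
     of_int (sign \<sigma>) * prod_list (permute_list \<sigma> zs))"

text \<open>
  \<open>lenlex less_than\<close> compares words first by length and then at the first
  position where they differ. The value of \<open>LM 0\<close> is unspecified.
\<close>

definition LM :: "'a::field free_algebra \<Rightarrow> nat list" where
  "LM f = (THE w. w \<in> Poly_Mapping.keys f \<and> (\<forall>v\<in>Poly_Mapping.keys f. v \<noteq> w \<longrightarrow> (v, w) \<in> lenlex less_than))"

definition in_normal_form :: "'a::field free_algebra set \<Rightarrow> 'a free_algebra \<Rightarrow> bool" where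
  "in_normal_form S f \<longleftrightarrow> (\<forall>w\<in>Poly_Mapping.keys f. \<forall>g\<in>S. \<not> sublist (LM g) w)"

definition red_step ::
    "nat set \<Rightarrow> 'a::field free_algebra set \<Rightarrow> 'a free_algebra \<Rightarrow> 'a free_algebra \<Rightarrow> bool" where
  "red_step X S h h' \<longleftrightarrow> (\<exists>g\<in>S. \<exists>w1\<in>lists X. \<exists>w2\<in>lists X.
     let c = Poly_Mapping.lookup h (w1 @ LM g @ w2)
     in c \<noteq> 0 \<and> h' = h - fscale c (word w1 * g * word w2))"

definition normal_form_of ::
    "nat set \<Rightarrow> 'a::field free_algebra set \<Rightarrow> 'a free_algebra \<Rightarrow> 'a free_algebra \<Rightarrow> bool" where
  "normal_form_of X S f h \<longleftrightarrow> in_normal_form S h \<and> (red_step X S)\<^sup>*\<^sup>* f h"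

end

theory Submission
  imports Defs
begin

text \<open>
  Expanding the alternating sum of all \<open>n + 1\<close> letters by its first or by its last letter shows that
  the alternating parts of the \<open>G i\<close> cancel in \<open>N\<close> (\<open>alternating_expansions_agree\<close>). What remains is
  the expression in the \<open>y i\<close>, and this is homogeneous of degree two, since \<open>\<phi>\<close> takes values in the
  span of the letters.

  In the definition of \<open>N\<close>, the summands \<open>G 1 * x 1\<close> and \<open>x (n + 1) * G (n + 1)\<close> occur with the signs
  that they have in the composition. So the composition is \<open>N\<close> plus a linear combination of the
  remaining products \<open>x i * G i\<close> with \<open>i \<le> n\<close> and \<open>G j * x j\<close> with \<open>j \<ge> 2\<close>. The leading words of
  these products are distinct, and the coefficients of a combination at these words form a
  triangular system: products with a letter on the left are told apart by the first letter, those
  with a letter on the right by the last letter, and mixed interference occurs only at two words.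
  Eliminating the products in the order of that system reduces the composition to \<open>N\<close>
  (\<open>reduce_combination\<close>).

  For uniqueness let \<open>n \<ge> 3\<close>. Every reduction step subtracts a multiple of one of the same products,
  because only words of length \<open>n + 1\<close> can be reduced and the overlap word never acquires a nonzero
  coefficient (\<open>red_combination\<close>). Hence every normal form is \<open>N\<close> plus a combination vanishing at all
  the leading words, and by triangularity that combination is zero
  (\<open>normal_form_combination_iff\<close>).

  The signs are handled by counting inversions: the coefficient of an arrangement of increasing
  letters in their alternating sum is \<open>-1\<close> to the power of its inversion number
  (\<open>lookup_alt_gen\<close>).
\<close>

section \<open>Signs of permutations and inversions of words\<close>

fun inversions :: "'b::linorder list \<Rightarrow> nat" where
  "inversions [] = 0"
| "inversions (x # xs) = length (filter (\<lambda>y. y < x) xs) + inversions xs"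

lemma inversions_append:
  "inversions (xs @ ys) =
     inversions xs + inversions ys + (\<Sum>x\<leftarrow>xs. length (filter (\<lambda>y. y < x) ys))"
  by (induction xs) simp_all

lemma length_filter_cong_mset:
  assumes "mset xs = mset ys"
  shows "length (filter P xs) = length (filter P ys)"
  by (metis assms mset_filter size_mset)

lemma length_filter_less_greater:
  fixes a :: "'b::linorder"
  assumes "a \<notin> set xs"
  shows "length (filter (\<lambda>y. y < a) xs) + length (filter (\<lambda>y. a < y) xs) = length xs"
  using assms by (induction xs) (auto simp: not_less_iff_gr_or_eq)

lemma sum_list_filter_Cons:
  "(\<Sum>x\<leftarrow>xs. length (filter (\<lambda>y. y < x) (b # v))) =
   length (filter (\<lambda>x. b < x) xs) + (\<Sum>x\<leftarrow>xs. length (filter (\<lambda>y. y < x) v))"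
  by (induction xs) simp_all

text \<open>
  The order of \<open>a\<close> relative to each entry of \<open>m\<close> is reversed, and likewise that of \<open>b\<close>. This makes
  \<open>2 * length m\<close> changes, and reversing the pair \<open>a, b\<close> itself makes one more.
\<close>

lemma inversions_swap_parity:
  assumes "a \<noteq> b" "a \<notin> set m" "b \<notin> set m"
  shows "even (inversions (u @ a # m @ b # v)) \<longleftrightarrow> odd (inversions (u @ b # m @ a # v))"
proof -
  have cross: "(\<Sum>x\<leftarrow>u. length (filter (\<lambda>y. y < x) (a # m @ b # v))) =
      (\<Sum>x\<leftarrow>u. length (filter (\<lambda>y. y < x) (b # m @ a # v)))"
    by (intro arg_cong[of _ _ sum_list] map_cong refl length_filter_cong_mset) simp
  have "inversions (a # m @ b # v) + inversions (b # m @ a # v) =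
    2 * (length (filter (\<lambda>y. y < a) v) + length (filter (\<lambda>y. y < b) v) + inversions m + inversions v
      + (\<Sum>x\<leftarrow>m. length (filter (\<lambda>y. y < x) v)) + length m) + 1"
    using assms(1) length_filter_less_greater[OF assms(2)] length_filter_less_greater[OF assms(3)]
    by (cases a b rule: linorder_cases)
       (simp_all add: inversions_append sum_list_filter_Cons del: filter.simps(2) sum_list_addf, simp_all)
  then have "even (inversions (a # m @ b # v)) \<longleftrightarrow> odd (inversions (b # m @ a # v))"
    by presburger
  then show ?thesis
    unfolding inversions_append[of u] cross by presburger
qed

lemma permute_list_transpose:
  assumes "i < j" "j < length xs"
  shows "permute_list (transpose i j) xs =
    take i xs @ xs ! j # take (j - Suc i) (drop (Suc i) xs) @ xs ! i # drop (Suc j) xs"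
proof (rule nth_equalityI)
  show "length (permute_list (transpose i j) xs) = length (take i xs @ xs ! j #
      take (j - Suc i) (drop (Suc i) xs) @ xs ! i # drop (Suc j) xs)"
    using assms by simp
  fix k assume "k < length (permute_list (transpose i j) xs)"
  then show "permute_list (transpose i j) xs ! k = (take i xs @ xs ! j #
      take (j - Suc i) (drop (Suc i) xs) @ xs ! i # drop (Suc j) xs) ! k"
    using assms
    by (auto simp: permute_list_def nth_append nth_Cons' transpose_def min_def)
qed

lemma split_at_two:
  assumes "i < j" "j < length xs"
  shows "xs = take i xs @ xs ! i # take (j - Suc i) (drop (Suc i) xs) @ xs ! j # drop (Suc j) xs"
proof -
  have "drop (Suc i) xs = take (j - Suc i) (drop (Suc i) xs) @ drop j xs"
    using assms append_take_drop_id[of "j - Suc i" "drop (Suc i) xs"] by simp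
  then show ?thesis
    using assms by (metis Cons_nth_drop_Suc id_take_nth_drop order.strict_trans)
qed

lemma inversions_sorted: "sorted xs \<Longrightarrow> inversions xs = 0"
  by (induction xs) (auto simp: filter_empty_conv)

text \<open>
  The inversion number turns signs of permutations into a statistic of words, which behaves well
  when a letter is added at either end. The equality holds for the identity, and composing with a
  transposition changes both sides.
\<close>

lemma sign_eq_inversions:
  fixes xs :: "'b::linorder list"
  assumes "sorted xs" "distinct xs" "\<sigma> permutes {..<length xs}"
  shows "sign \<sigma> = (-1) ^ inversions (permute_list \<sigma> xs)"
  using finite_lessThan assms(3)
proof (induction rule: permutes_rev_induct)
  case id
  show ?case using assms(1) by (simp add: inversions_sorted)
next
  case (swap a b \<sigma>)
  let ?ys = "permute_list \<sigma> xs"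
  have dist: "distinct ?ys" using assms(2) swap.hyps by simp
  have tr: "transpose a b permutes {..<length xs}"
    using swap.hyps by (simp add: permutes_swap_id)
  have parity: "even (inversions (permute_list (transpose i j) ?ys)) \<longleftrightarrow> odd (inversions ?ys)"
    if ij: "i < j" "j < length xs" for i j
  proof -
    let ?m = "take (j - Suc i) (drop (Suc i) ?ys)"
    have split: "?ys = take i ?ys @ ?ys ! i # ?m @ ?ys ! j # drop (Suc j) ?ys"
      using ij by (intro split_at_two) simp_all
    have "distinct (take i ?ys @ ?ys ! i # ?m @ ?ys ! j # drop (Suc j) ?ys)"
      using dist split by simp
    then have "?ys ! i \<noteq> ?ys ! j" "?ys ! i \<notin> set ?m" "?ys ! j \<notin> set ?m" by auto
    then show ?thesis
      using inversions_swap_parity[of "?ys ! i" "?ys ! j" ?m "take i ?ys" "drop (Suc j) ?ys"]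
        split permute_list_transpose[of i j ?ys] ij by auto
  qed
  have "even (inversions (permute_list (transpose a b) ?ys)) \<longleftrightarrow> odd (inversions ?ys)"
    using parity[of a b] parity[of b a] swap.hyps by (cases a b rule: linorder_cases) (auto simp: transpose_commute)
  moreover have "sign (\<sigma> \<circ> transpose a b) = - sign \<sigma>"
    using swap.hyps tr
    by (subst sign_compose) (auto intro: permutes_imp_permutation simp: sign_swap_id)
  ultimately show ?case
    using swap.IH permute_list_compose[OF tr, of \<sigma>] by (simp add: minus_one_power_iff del: o_apply comp_apply)
qed

text \<open>
  The reversal of a list of length \<open>k\<close> has \<open>k choose 2\<close> inversions, a number with the parity of
  \<open>k div 2\<close>. This is why the factor \<open>(-1) ^ (n div 2)\<close> makes the leading coefficients equal to one.
\<close>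

lemma inversions_rev_parity:
  assumes "sorted xs" "distinct xs"
  shows "even (inversions (rev xs)) \<longleftrightarrow> even (length xs div 2)"
  using assms
proof (induction xs)
  case (Cons x xs)
  have "\<forall>y\<in>set xs. x < y" using Cons.prems by (auto simp: less_le)
  then have "filter (\<lambda>y. x < y) xs = xs" by simp
  then have "inversions (rev (x # xs)) = inversions (rev xs) + length xs"
    by (simp add: inversions_append sum_list_filter_Cons del: filter.simps(2) flip: rev_filter)
  then show ?case using Cons by simp presburger
qed simp

section \<open>Coefficients in the free algebra\<close>

lemma word_mult: "word u * word v = word (u @ v)"
  by (simp add: word_def mult_single plus_list_def)

lemma word_Nil: "word [] = 1"
  by (simp add: word_def flip: single_one zero_list_def)

lemma prod_list_gen: "prod_list (map gen l) = word l"
  by (induction l) (simp_all add: word_Nil gen_def word_mult)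

lemma lookup_word_mult:
  "Poly_Mapping.lookup (word u * f) w =
     (if prefix u w then Poly_Mapping.lookup f (drop (length u) w) else 0)"
proof -
  have "Poly_Mapping.lookup (word u * f) w =
      (\<Sum>l. (\<Sum>q. Poly_Mapping.lookup f q when w = l @ q) when l = u)"
    unfolding lookup_mult word_def plus_list_def
    by (intro Sum_any.cong) (simp add: lookup_single when_def)
  also have "\<dots> = (\<Sum>q. Poly_Mapping.lookup f q when w = u @ q)"
    by simp
  also have "\<dots> = (if prefix u w then Poly_Mapping.lookup f (drop (length u) w) else 0)"
  proof (cases "prefix u w")
    case True
    then obtain v where "w = u @ v" by (auto simp: prefix_def)
    then show ?thesis by simp
  next
    case False
    then have "w \<noteq> u @ q" for q by auto
    then show ?thesis using False by simp
  qed
  finally show ?thesis .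
qed

lemma lookup_mult_word:
  "Poly_Mapping.lookup (f * word u) w =
     (if suffix u w then Poly_Mapping.lookup f (take (length w - length u) w) else 0)"
proof -
  have "Poly_Mapping.lookup (f * word u) w =
      (\<Sum>l. Poly_Mapping.lookup f l * (\<Sum>q. (1 when w = l @ q) when q = u))"
    unfolding lookup_mult word_def plus_list_def
    by (intro Sum_any.cong arg_cong2[of _ _ _ _ "(*)"] refl) (simp add: lookup_single when_def)
  also have "\<dots> = (\<Sum>l. Poly_Mapping.lookup f l when w = l @ u)"
    by (simp add: mult_when)
  also have "\<dots> = (if suffix u w then Poly_Mapping.lookup f (take (length w - length u) w) else 0)"
  proof (cases "suffix u w")
    case True
    then obtain v where "w = v @ u" by (auto simp: suffix_def)
    then show ?thesis by (simp add: suffix_def)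
  next
    case False
    then have "w \<noteq> l @ u" for l by (auto simp: suffix_def)
    then show ?thesis using False by simp
  qed
  finally show ?thesis .
qed

lemma lookup_gen_mult:
  "Poly_Mapping.lookup (gen i * f) w =
     (if w \<noteq> [] \<and> hd w = i then Poly_Mapping.lookup f (tl w) else 0)"
  by (cases w) (simp_all add: gen_def lookup_word_mult)

lemma lookup_mult_gen:
  "Poly_Mapping.lookup (f * gen i) w =
     (if w \<noteq> [] \<and> last w = i then Poly_Mapping.lookup f (butlast w) else 0)"
  by (cases w rule: rev_cases) (auto simp add: gen_def lookup_mult_word)

lemma lookup_minus_one_power_mult:
  "Poly_Mapping.lookup ((-1) ^ k * f) w = (-1) ^ k * Poly_Mapping.lookup (f :: 'a::field free_algebra) w"
  by (simp add: minus_one_power_iff)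

lemma lookup_of_int_sign_mult:
  "Poly_Mapping.lookup (of_int (sign \<sigma>) * f) w =
     of_int (sign \<sigma>) * Poly_Mapping.lookup (f :: 'a::field free_algebra) w"
  by (cases \<sigma> rule: sign_cases) simp_all

lemma permute_list_inj:
  assumes "distinct xs" "\<sigma> permutes {..<length xs}" "\<tau> permutes {..<length xs}"
    and "permute_list \<sigma> xs = permute_list \<tau> xs"
  shows "\<sigma> = \<tau>"
proof
  fix i
  show "\<sigma> i = \<tau> i"
  proof (cases "i < length xs")
    case True
    then have "xs ! \<sigma> i = xs ! \<tau> i"
      using assms by (metis permute_list_nth)
    moreover have "\<sigma> i < length xs" "\<tau> i < length xs"
      using True assms(2,3) permutes_in_image by fastforce+
    ultimately show ?thesis using assms(1) nth_eq_iff_index_eq by blast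
  next
    case False
    then show ?thesis using assms(2,3) by (simp add: permutes_not_in)
  qed
qed

text \<open>
  Since the letters are distinct, at most one permutation contributes to each word.
\<close>

lemma lookup_alt_gen:
  assumes "sorted xs" "distinct xs"
  shows "Poly_Mapping.lookup (alt (map gen xs) :: 'a::field free_algebra) w =
    (if mset w = mset xs then (-1) ^ inversions w else 0)"
proof -
  let ?P = "{\<sigma>. \<sigma> permutes {..<length xs}}"
  have "Poly_Mapping.lookup (alt (map gen xs) :: 'a free_algebra) w =
      (\<Sum>\<sigma>\<in>?P. of_int (sign \<sigma>) * Poly_Mapping.lookup (word (permute_list \<sigma> xs)) w)"
    unfolding alt_def lookup_sum lookup_of_int_sign_mult length_map
    by (intro sum.cong refl) (simp add: permute_list_map prod_list_gen)
  also have "\<dots> = (\<Sum>\<sigma>\<in>?P. if permute_list \<sigma> xs = w then (-1) ^ inversions w else 0)"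
    using assms
    by (intro sum.cong refl)
       (auto simp: word_def lookup_single when_def sign_eq_inversions of_int_power)
  also have "\<dots> = (if mset w = mset xs then (-1) ^ inversions w else 0)"
  proof (cases "mset w = mset xs")
    case True
    then obtain \<tau> where \<tau>: "\<tau> permutes {..<length xs}" "permute_list \<tau> xs = w"
      by (rule mset_eq_permutation)
    have "(\<Sum>\<sigma>\<in>?P. if permute_list \<sigma> xs = w then (-1) ^ inversions w else 0) =
        (\<Sum>\<sigma>\<in>?P. if \<sigma> = \<tau> then (-1) ^ inversions w else (0::'a))"
      using \<tau> permute_list_inj[OF assms(2)] by (intro sum.cong refl) auto
    then show ?thesis using True \<tau>(1) by (simp add: finite_permutations)
  next
    case False
    then have "permute_list \<sigma> xs \<noteq> w" if "\<sigma> \<in> ?P" for \<sigma>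
      using that by auto
    then show ?thesis using False by simp
  qed
  finally show ?thesis .
qed

section \<open>The leading words\<close>

text \<open>
  At the first position where it differs, a rearrangement of a decreasing word has one of the later,
  hence smaller, letters.
\<close>

lemma permutation_lenlex_sorted_rev:
  fixes d :: "nat list"
  assumes "sorted (rev d)" "mset v = mset d" "v \<noteq> d"
  shows "(v, d) \<in> lenlex less_than"
  using assms
proof (induction d arbitrary: v)
  case (Cons a d)
  from Cons.prems(2) obtain b v' where v: "v = b # v'" by (cases v) auto
  have "b \<in> set (a # d)" using Cons.prems(2) v by (metis list.set_intros(1) mset_eq_setD)
  then have "b \<le> a" using Cons.prems(1) by (auto simp: sorted_append)
  have "length v' = length d" using Cons.prems(2) v by (metis length_Cons mset_eq_length nat.inject)
  show ?case
  proof (cases "b = a")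
    case True
    with Cons v show ?thesis by (simp add: Cons_lenlex_iff sorted_append)
  next
    case False
    with \<open>b \<le> a\<close> \<open>length v' = length d\<close> v show ?thesis by (simp add: Cons_lenlex_iff)
  qed
qed simp

lemma LM_eqI:
  assumes "w \<in> Poly_Mapping.keys f"
    and "\<And>v. v \<in> Poly_Mapping.keys f \<Longrightarrow> v \<noteq> w \<Longrightarrow> (v, w) \<in> lenlex less_than"
  shows "LM f = w"
  unfolding LM_def
proof (rule the_equality)
  fix u assume u: "u \<in> Poly_Mapping.keys f \<and> (\<forall>v\<in>Poly_Mapping.keys f. v \<noteq> u \<longrightarrow> (v, u) \<in> lenlex less_than)"
  show "u = w"
  proof (rule ccontr)
    assume "u \<noteq> w"
    with u assms have "(u, w) \<in> lenlex less_than" "(w, u) \<in> lenlex less_than" by auto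
    then show False using asym_lenlex[OF asym_less_than] by (meson asymD)
  qed
qed (use assms in auto)

definition letters_omitting :: "nat \<Rightarrow> nat \<Rightarrow> nat list" where
  "letters_omitting n i = filter (\<lambda>j. j \<noteq> i) [1..<n + 2]"

definition lead_word :: "nat \<Rightarrow> nat \<Rightarrow> nat list" where
  "lead_word n i = rev (letters_omitting n i)"

lemma sorted_letters_omitting: "sorted (letters_omitting n i)"
  and distinct_letters_omitting: "distinct (letters_omitting n i)"
  unfolding letters_omitting_def by (intro sorted_wrt_filter distinct_filter sorted_upt distinct_upt)+

lemma mset_letters_omitting:
  assumes "i \<in> {1..n + 1}"
  shows "add_mset i (mset (letters_omitting n i)) = mset [1..<n + 2]"
proof -
  have "{j \<in> {1..<n + 2}. j \<noteq> i} = {1..<n + 2} - {i}" by auto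
  then have "mset (letters_omitting n i) = mset_set ({1..<n + 2} - {i})"
    unfolding letters_omitting_def mset_filter mset_upt by (subst filter_mset_mset_set) simp_all
  then show ?thesis
    unfolding mset_upt using assms by (subst mset_set.remove[of "{1..<n + 2}" i]) auto
qed

lemma length_letters_omitting: "i \<in> {1..n + 1} \<Longrightarrow> length (letters_omitting n i) = n"
  using arg_cong[OF mset_letters_omitting, of i n size] by (simp del: upt_Suc)

lemma length_lead_word: "i \<in> {1..n + 1} \<Longrightarrow> length (lead_word n i) = n"
  by (simp add: lead_word_def length_letters_omitting)

lemma mset_lead_word: "mset (lead_word n i) = mset (letters_omitting n i)"
  by (simp add: lead_word_def)

lemma hd_lead_word:
  assumes "n \<ge> 1"
  shows "hd (lead_word n i) = (if i = n + 1 then n else n + 1)"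
proof -
  have "[1..<n + 2] = [1..<n] @ [n, n + 1]" using assms by (simp add: upt_Suc_append)
  then show ?thesis by (auto simp: lead_word_def letters_omitting_def)
qed

lemma last_lead_word:
  assumes "n \<ge> 1"
  shows "last (lead_word n i) = (if i = 1 then 2 else 1)"
proof -
  have "[1..<n + 2] = 1 # 2 # [3..<n + 2]" using assms by (simp add: upt_conv_Cons eval_nat_numeral del: upt_Suc)
  then show ?thesis by (auto simp: lead_word_def letters_omitting_def)
qed

lemma lead_word_last: "lead_word n (n + 1) = rev [1..<n + 1]"
proof -
  have "filter (\<lambda>j. j \<noteq> n + 1) [1..<n + 1] = [1..<n + 1]" by (intro filter_True) auto
  then show ?thesis by (simp add: lead_word_def letters_omitting_def)
qed

lemma lead_word_first: "lead_word n 1 = rev [2..<n + 2]"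
proof -
  have "filter (\<lambda>j. j \<noteq> 1) [2..<n + 2] = [2..<n + 2]" by (intro filter_True) auto
  moreover have "[1..<n + 2] = 1 # [2..<n + 2]" by (simp add: upt_conv_Cons eval_nat_numeral del: upt_Suc)
  ultimately show ?thesis by (simp add: lead_word_def letters_omitting_def del: upt_Suc)
qed

text \<open>
  The two leading words overlap in this decreasing word of all \<open>n + 1\<close> letters, from which the
  composition \<open>G 1 * x 1 - x (n + 1) * G (n + 1)\<close> arises.
\<close>

lemma lead_word_overlap: "(n + 1) # lead_word n (n + 1) = lead_word n 1 @ [1]"
proof -
  have "[1..<n + 2] = 1 # [2..<n + 2]" by (simp add: upt_conv_Cons eval_nat_numeral del: upt_Suc)
  moreover have "[1..<n + 2] = [1..<n + 1] @ [n + 1]" by simp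
  ultimately show ?thesis unfolding lead_word_first lead_word_last
    by (metis rev.simps(2) rev_eq_Cons_iff rev_rev_ident)
qed

lemma length_filter_less_upt:
  assumes "k \<in> {1..n + 1}"
  shows "length (filter (\<lambda>y. y < k) [1..<n + 2]) = k - 1"
    and "length (filter (\<lambda>y. k < y) [1..<n + 2]) = n + 1 - k"
proof -
  have "{i. i < n + 1 \<and> [1..<n + 2] ! i < k} = {..<k - 1}"
    "{i. i < n + 1 \<and> k < [1..<n + 2] ! i} = {k..<n + 1}"
    using assms by (auto simp del: upt_Suc)
  then show "length (filter (\<lambda>y. y < k) [1..<n + 2]) = k - 1"
    "length (filter (\<lambda>y. k < y) [1..<n + 2]) = n + 1 - k"
    by (simp_all add: length_filter_conv_card del: upt_Suc)
qed

text \<open>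
  In a word containing each of the letters \<open>1, \<dots>, n + 1\<close> once, an initial letter \<open>k\<close> precedes
  exactly the \<open>k - 1\<close> smaller letters.
\<close>

lemma inversions_Cons_full:
  assumes "mset (k # w) = mset [1..<n + 2]"
  shows "inversions (k # w) + 1 = k + inversions w"
proof -
  have "k \<in> set (k # w)" by simp
  then have k: "k \<in> {1..n + 1}"
    unfolding mset_eq_setD[OF assms] by (simp del: upt_Suc)
  have "length (filter (\<lambda>y. y < k) (k # w)) = k - 1"
    using length_filter_cong_mset[OF assms] length_filter_less_upt(1)[OF k] by (rule trans)
  then show ?thesis using k by simp
qed

text \<open>
  A final letter \<open>k\<close> follows exactly the \<open>n + 1 - k\<close> larger letters.
\<close>

lemma inversions_snoc_full:
  assumes "mset (w @ [k]) = mset [1..<n + 2]"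
  shows "inversions (w @ [k]) + k = n + 1 + inversions w"
proof -
  have "k \<in> set (w @ [k])" by simp
  then have k: "k \<in> {1..n + 1}"
    unfolding mset_eq_setD[OF assms] by (simp del: upt_Suc)
  have "length (filter (\<lambda>y. k < y) (w @ [k])) = n + 1 - k"
    using length_filter_cong_mset[OF assms] length_filter_less_upt(2)[OF k] by (rule trans)
  then show ?thesis using k by (simp add: inversions_append sum_list_filter_Cons del: filter.simps(2))
qed

section \<open>Expansions of the alternating sum\<close>

lemma lookup_sum_gen_mult:
  fixes a :: "nat \<Rightarrow> 'a::field"
  assumes "finite I" "w \<noteq> []"
  shows "(\<Sum>i\<in>I. a i * Poly_Mapping.lookup (gen i * H i) w) =
     (if hd w \<in> I then a (hd w) * Poly_Mapping.lookup (H (hd w)) (tl w) else 0)"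
proof -
  have "(\<Sum>i\<in>I. a i * Poly_Mapping.lookup (gen i * H i) w) =
     (\<Sum>i\<in>I. if i = hd w then a i * Poly_Mapping.lookup (H i) (tl w) else 0)"
    using assms(2) by (intro sum.cong refl) (auto simp: lookup_gen_mult)
  then show ?thesis using assms(1) by simp
qed

lemma lookup_sum_mult_gen:
  fixes a :: "nat \<Rightarrow> 'a::field"
  assumes "finite I" "w \<noteq> []"
  shows "(\<Sum>i\<in>I. a i * Poly_Mapping.lookup (H i * gen i) w) =
     (if last w \<in> I then a (last w) * Poly_Mapping.lookup (H (last w)) (butlast w) else 0)"
proof -
  have "(\<Sum>i\<in>I. a i * Poly_Mapping.lookup (H i * gen i) w) =
     (\<Sum>i\<in>I. if i = last w then a i * Poly_Mapping.lookup (H i) (butlast w) else 0)"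
    using assms(2) by (intro sum.cong refl) (auto simp: lookup_mult_gen)
  then show ?thesis using assms(1) by simp
qed

lemma alt_omit_gen: "alt (omit n gen i) = alt (map gen (letters_omitting n i))"
  by (simp add: omit_def letters_omitting_def)

lemma lookup_alt_omit:
  "Poly_Mapping.lookup (alt (omit n gen i) :: 'a::field free_algebra) w =
    (if mset w = mset (letters_omitting n i) then (-1) ^ inversions w else 0)"
  unfolding alt_omit_gen
  by (rule lookup_alt_gen) (rule sorted_letters_omitting distinct_letters_omitting)+

lemma lookup_alt_omit_lead_word:
  assumes "i \<in> {1..n + 1}"
  shows "Poly_Mapping.lookup (alt (omit n gen i) :: 'a::field free_algebra) (lead_word n i) =
    (-1) ^ (n div 2)"
  using inversions_rev_parity[OF sorted_letters_omitting distinct_letters_omitting, of n i] assms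
  by (simp add: lookup_alt_omit mset_lead_word minus_one_power_iff lead_word_def
      length_letters_omitting)

text \<open>
  Both the left-hand products and the right-hand products, the latter with their factor \<open>(-1) ^ n\<close>,
  sum to the negative of the alternating sum of all \<open>n + 1\<close> letters, expanded by the first and by
  the last letter. On coefficients: the removal of the first or the last letter of an arrangement
  \<open>w\<close> of the letters changes its inversion number by an amount depending on that letter only, so
  both sums have the coefficient \<open>- ((-1) ^ inversions w)\<close> at \<open>w\<close>.
\<close>

lemma alternating_expansions_agree:
  "(\<Sum>i = 1..n + 1. (-1) ^ i * (gen i * alt (omit n gen i) -
      (-1) ^ n * (alt (omit n gen i) * gen i))) = (0 :: 'a::field free_algebra)"
proof (rule poly_mapping_eqI)
  fix w
  let ?A = "\<lambda>i. alt (omit n gen i) :: 'a free_algebra"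
  let ?full = "mset w = mset [1..<n + 2]"
  have lhs: "Poly_Mapping.lookup (\<Sum>i = 1..n + 1. (-1) ^ i * (gen i * ?A i - (-1) ^ n * (?A i * gen i))) w =
     (\<Sum>i = 1..n + 1. (-1) ^ i * Poly_Mapping.lookup (gen i * ?A i) w) -
     (-1) ^ n * (\<Sum>i = 1..n + 1. (-1) ^ i * Poly_Mapping.lookup (?A i * gen i) w)"
    by (simp add: lookup_sum lookup_minus_one_power_mult lookup_minus right_diff_distrib
        sum_subtractf sum_distrib_left mult.left_commute del: sum.cl_ivl_Suc)
  show "Poly_Mapping.lookup (\<Sum>i = 1..n + 1. (-1) ^ i * (gen i * ?A i - (-1) ^ n * (?A i * gen i))) w =
     Poly_Mapping.lookup 0 w"
  proof (cases "w = []")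
    case True
    then show ?thesis unfolding lhs by (simp add: lookup_gen_mult lookup_mult_gen)
  next
    case False
    have hd: "w = hd w # tl w" and last: "w = butlast w @ [last w]" using False by simp_all
    have left: "(\<Sum>i = 1..n + 1. (-1) ^ i * Poly_Mapping.lookup (gen i * ?A i) w) =
        (if ?full then - ((-1) ^ inversions w) else 0)"
    proof (cases "hd w \<in> {1..n + 1}")
      case True
      have "mset (tl w) = mset (letters_omitting n (hd w)) \<longleftrightarrow> ?full"
        using mset_letters_omitting[OF True] hd by (metis add_mset_add_single add_right_cancel mset.simps(2))
      moreover have "even (inversions w) \<longleftrightarrow> odd (hd w + inversions (tl w))" if ?full
        using inversions_Cons_full[of "hd w" "tl w" n] that hd by (metis even_add odd_one)
      ultimately show ?thesis
        using True by (subst lookup_sum_gen_mult[OF _ False]) (auto simp: lookup_alt_omit minus_one_power_iff)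
    next
      case False': False
      then have "\<not> ?full" using mset_eq_setD[of w "[1..<n + 2]"] hd_in_set[OF \<open>w \<noteq> []\<close>] by (auto simp del: upt_Suc)
      then show ?thesis using False' by (subst lookup_sum_gen_mult[OF _ False]) auto
    qed
    have right: "(\<Sum>i = 1..n + 1. (-1) ^ i * Poly_Mapping.lookup (?A i * gen i) w) =
        (if ?full then - ((-1) ^ (n + inversions w)) else 0)"
    proof (cases "last w \<in> {1..n + 1}")
      case True
      have "mset w = add_mset (last w) (mset (butlast w))"
        by (subst last) simp
      then have "mset (butlast w) = mset (letters_omitting n (last w)) \<longleftrightarrow> ?full"
        using mset_letters_omitting[OF True] by (metis add_mset_add_single add_right_cancel)
      moreover have "even (n + inversions w) \<longleftrightarrow> odd (last w + inversions (butlast w))" if ?full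
        using inversions_snoc_full[of "butlast w" "last w" n] that last by (metis even_add odd_one)
      ultimately show ?thesis
        using True by (subst lookup_sum_mult_gen[OF _ False]) (auto simp: lookup_alt_omit minus_one_power_iff)
    next
      case False': False
      then have "\<not> ?full" using mset_eq_setD[of w "[1..<n + 2]"] last_in_set[OF \<open>w \<noteq> []\<close>] by (auto simp del: upt_Suc)
      then show ?thesis using False' by (subst lookup_sum_mult_gen[OF _ False]) auto
    qed
    show ?thesis unfolding lhs left right by (simp add: minus_one_power_iff)
  qed
qed

section \<open>Reduction of combinations of products\<close>

lemma update_scaled_sum:
  fixes a :: "nat \<Rightarrow> 'a::field" and T :: "nat \<Rightarrow> 'a free_algebra"
  assumes "finite I" "i \<in> I"
  shows "(\<Sum>k\<in>I. fscale ((a(i := a i - c)) k) (T k)) = (\<Sum>k\<in>I. fscale (a k) (T k)) - fscale c (T i)"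
proof (rule poly_mapping_eqI)
  fix w
  have "(\<Sum>k\<in>I. (a(i := a i - c)) k * Poly_Mapping.lookup (T k) w) =
      (\<Sum>k\<in>I. a k * Poly_Mapping.lookup (T k) w - (if k = i then c * Poly_Mapping.lookup (T i) w else 0))"
    by (intro sum.cong refl) (simp add: left_diff_distrib)
  also have "\<dots> = (\<Sum>k\<in>I. a k * Poly_Mapping.lookup (T k) w) - c * Poly_Mapping.lookup (T i) w"
    using assms by (simp add: sum_subtractf)
  finally show "Poly_Mapping.lookup (\<Sum>k\<in>I. fscale ((a(i := a i - c)) k) (T k)) w =
     Poly_Mapping.lookup ((\<Sum>k\<in>I. fscale (a k) (T k)) - fscale c (T i)) w"
    by (simp add: lookup_sum lookup_minus lookup_fscale)
qed

text \<open>
  The products subtracted when words of length \<open>n + 1\<close> in the composition are reduced. The indices \<open>n + 1\<close> on the left and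
  \<open>1\<close> on the right are left out: these are the two products forming the composition, and their
  common leading word is the overlap word.
\<close>

definition combination ::
    "nat \<Rightarrow> (nat \<Rightarrow> 'a::field free_algebra) \<Rightarrow> (nat \<Rightarrow> 'a) \<Rightarrow> (nat \<Rightarrow> 'a) \<Rightarrow> 'a free_algebra" where
  "combination n G a b =
    (\<Sum>i\<in>{1..n}. fscale (a i) (gen i * G i)) + (\<Sum>j\<in>{2..n + 1}. fscale (b j) (G j * gen j))"

lemma combination_update_left:
  "i \<in> {1..n} \<Longrightarrow>
    combination n G (a(i := a i - c)) b = combination n G a b - fscale c (gen i * G i)"
  unfolding combination_def by (subst update_scaled_sum) simp_all

lemma combination_update_right:
  "j \<in> {2..n + 1} \<Longrightarrow>
    combination n G a (b(j := b j - c)) = combination n G a b - fscale c (G j * gen j)"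
  unfolding combination_def by (subst update_scaled_sum) simp_all

text \<open>
  All words of \<open>gen i * G i\<close> begin with \<open>i\<close> and all words of \<open>G j * gen j\<close> end in \<open>j\<close>, so at most one product
  of each kind contributes to the coefficient of a given word.
\<close>

lemma lookup_combination:
  assumes "w \<noteq> []"
  shows "Poly_Mapping.lookup (combination n G a b) w =
    (if hd w \<in> {1..n} then a (hd w) * Poly_Mapping.lookup (G (hd w)) (tl w) else 0) +
    (if last w \<in> {2..n + 1} then b (last w) * Poly_Mapping.lookup (G (last w)) (butlast w) else 0)"
  unfolding combination_def lookup_add lookup_sum lookup_fscale
  by (simp only: lookup_sum_gen_mult[OF finite_atLeastAtMost assms]
      lookup_sum_mult_gen[OF finite_atLeastAtMost assms])

text \<open>
  All that the reductions need of the elements \<open>G i\<close> is their support and leading coefficients: the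
  top part consists of arrangements of the letters other than \<open>i\<close>, the rest has degree one, and the
  decreasing arrangement has coefficient one.
\<close>

locale rewriting_system =
  fixes n :: nat and G :: "nat \<Rightarrow> 'a::field free_algebra"
  assumes n: "n \<ge> 2"
    and keys: "\<And>i w. i \<in> {1..n + 1} \<Longrightarrow> w \<in> Poly_Mapping.keys (G i) \<Longrightarrow>
      mset w = mset (letters_omitting n i) \<or> length w = 1"
    and monic: "\<And>i. i \<in> {1..n + 1} \<Longrightarrow> Poly_Mapping.lookup (G i) (lead_word n i) = 1"
begin

lemma LM_eq:
  assumes "i \<in> {1..n + 1}"
  shows "LM (G i) = lead_word n i"
proof (rule LM_eqI)
  show "lead_word n i \<in> Poly_Mapping.keys (G i)"
    using monic[OF assms] by (simp add: in_keys_iff)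
  fix v assume v: "v \<in> Poly_Mapping.keys (G i)" "v \<noteq> lead_word n i"
  from keys[OF assms v(1)] show "(v, lead_word n i) \<in> lenlex less_than"
  proof
    assume "mset v = mset (letters_omitting n i)"
    then show ?thesis
      using v(2) by (intro permutation_lenlex_sorted_rev) (simp_all add: lead_word_def sorted_letters_omitting)
  next
    assume "length v = 1"
    then show ?thesis
      using n length_lead_word[OF assms] by (simp add: lenlex_conv)
  qed
qed

abbreviation "red \<equiv> red_step {1..n + 1} (G ` {1..n + 1})"

lemma red_left:
  assumes "i \<in> {1..n + 1}" "Poly_Mapping.lookup h (i # lead_word n i) = c" "c \<noteq> 0"
  shows "red h (h - fscale c (gen i * G i))"
  unfolding red_step_def using assms
  by (intro bexI[of _ "G i"] bexI[of _ "[i]"] bexI[of _ "[]"])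
     (auto simp: LM_eq word_Nil gen_def)

lemma red_right:
  assumes "i \<in> {1..n + 1}" "Poly_Mapping.lookup h (lead_word n i @ [i]) = c" "c \<noteq> 0"
  shows "red h (h - fscale c (G i * gen i))"
  unfolding red_step_def using assms
  by (intro bexI[of _ "G i"] bexI[of _ "[i]"] bexI[of _ "[]"])
     (auto simp: LM_eq word_Nil gen_def)

lemma lead_word_nonempty: "i \<in> {1..n + 1} \<Longrightarrow> lead_word n i \<noteq> []"
  using n length_lead_word by fastforce

text \<open>
  This lemma and the next express that the coefficients of a combination at the leading words of its
  products form a triangular system. A leading word \<open>i # lead_word n i\<close> ends in \<open>1\<close> unless \<open>i = 1\<close>,
  when it ends in \<open>2\<close>; so the only interference comes from \<open>G 2 * gen 2\<close>. Symmetrically,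
  \<open>lead_word n j @ [j]\<close> begins with \<open>n + 1\<close> unless \<open>j = n + 1\<close>, when it begins with \<open>n\<close>.
\<close>

lemma lookup_combination_left:
  assumes "i \<in> {1..n}"
  shows "Poly_Mapping.lookup (combination n G a b) (i # lead_word n i) =
    a i + (if i = 1 then b 2 * Poly_Mapping.lookup (G 2) (butlast (1 # lead_word n 1)) else 0)"
  using assms n lead_word_nonempty[of i] monic[of i] last_lead_word[of n i]
  by (subst lookup_combination) auto

lemma lookup_combination_right:
  assumes "j \<in> {2..n + 1}"
  shows "Poly_Mapping.lookup (combination n G a b) (lead_word n j @ [j]) =
    b j + (if j = n + 1 then a n * Poly_Mapping.lookup (G n) (tl (lead_word n j @ [j])) else 0)"
  using assms n lead_word_nonempty[of j] monic[of j] hd_lead_word[of n j]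
  by (subst lookup_combination) auto

text \<open>
  The overlap word begins with \<open>n + 1\<close> and ends in \<open>1\<close>, so it could only come from the two
  products left out of the combinations.
\<close>

lemma lookup_combination_overlap:
  "Poly_Mapping.lookup (combination n G a b) (lead_word n 1 @ [1]) = 0"
  using n lead_word_nonempty[of 1] hd_lead_word[of n 1]
  by (subst lookup_combination) auto

lemma lookup_combination_support:
  assumes "length w \<ge> 3" "Poly_Mapping.lookup (combination n G a b) w \<noteq> 0"
  shows "mset w = mset [1..<n + 2]"
proof -
  have ne: "w \<noteq> []" using assms(1) by auto
  consider
    "hd w \<in> {1..n}" "Poly_Mapping.lookup (G (hd w)) (tl w) \<noteq> 0"
  | "last w \<in> {2..n + 1}" "Poly_Mapping.lookup (G (last w)) (butlast w) \<noteq> 0"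
  proof -
    have "Poly_Mapping.lookup (combination n G a b) w = 0"
      if "\<not> (hd w \<in> {1..n} \<and> Poly_Mapping.lookup (G (hd w)) (tl w) \<noteq> 0)"
        "\<not> (last w \<in> {2..n + 1} \<and> Poly_Mapping.lookup (G (last w)) (butlast w) \<noteq> 0)"
      unfolding lookup_combination[OF ne] using that by auto
    with assms(2) that show ?thesis by blast
  qed
  then show ?thesis
  proof cases
    case 1
    then have "mset (tl w) = mset (letters_omitting n (hd w))"
      using keys[of "hd w" "tl w"] assms(1) by (auto simp: in_keys_iff)
    then show ?thesis
      using mset_letters_omitting[of "hd w" n] 1(1) ne
      by (metis atLeastAtMost_iff hd_Cons_tl le_add1 le_trans mset.simps(2))
  next
    case 2
    then have "mset (butlast w) = mset (letters_omitting n (last w))"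
      using keys[of "last w" "butlast w"] assms(1) by (auto simp: in_keys_iff)
    moreover have "mset w = add_mset (last w) (mset (butlast w))"
      using ne by (cases w rule: rev_cases) simp_all
    ultimately show ?thesis
      using mset_letters_omitting[of "last w" n] 2(1) by auto
  qed
qed

lemma combination_zero: "combination n G (\<lambda>_. 0) (\<lambda>_. 0) = 0"
  by (rule poly_mapping_eqI) (simp add: combination_def lookup_add lookup_sum lookup_fscale)

lemma combination_cong:
  assumes "\<And>i. i \<in> {1..n} \<Longrightarrow> a i = a' i" "\<And>j. j \<in> {2..n + 1} \<Longrightarrow> b j = b' j"
  shows "combination n G a b = combination n G a' b'"
  unfolding combination_def using assms by (intro arg_cong2[of _ _ _ _ "(+)"] sum.cong refl) auto

text \<open>
  The triangular system is solved in the order \<open>b 2, \<dots>, b n\<close>, then \<open>a 1, \<dots>, a n\<close>, then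
  \<open>b (n + 1)\<close>.
\<close>

lemma combination_eq_0:
  assumes left: "\<And>i. i \<in> {1..n} \<Longrightarrow>
      Poly_Mapping.lookup (combination n G a b) (i # lead_word n i) = 0"
    and right: "\<And>j. j \<in> {2..n + 1} \<Longrightarrow>
      Poly_Mapping.lookup (combination n G a b) (lead_word n j @ [j]) = 0"
  shows "combination n G a b = 0"
proof -
  have b: "b j = 0" if "j \<in> {2..n}" for j
    using right[of j] lookup_combination_right[of j a b] that by auto
  have a: "a i = 0" if "i \<in> {1..n}" for i
    using left[OF that] lookup_combination_left[OF that, of a b] b[of 2] n by (auto split: if_splits)
  have "b (n + 1) = 0"
    using right[of "n + 1"] lookup_combination_right[of "n + 1" a b] a[of n] n by auto
  with b have "b j = 0" if "j \<in> {2..n + 1}" for j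
    using that by (cases "j = n + 1") auto
  with a show ?thesis
    using combination_cong[of a "\<lambda>_. 0" b "\<lambda>_. 0"] combination_zero by simp
qed

text \<open>
  As long as some coefficient is nonzero, by triangularity there is a nonzero one that equals the
  coefficient of the corresponding leading word, so one reduction step removes it and leaves the
  others alone. The polynomial \<open>N\<close> does not interfere, because the leading words of the
  products have length \<open>n + 1 \<ge> 3\<close>.
\<close>

lemma reduce_combination:
  assumes N: "\<And>w. w \<in> Poly_Mapping.keys N \<Longrightarrow> length w = 2"
  shows "red\<^sup>*\<^sup>* (N + combination n G a b) N"
proof (induction "card {i \<in> {1..n}. a i \<noteq> 0} + card {j \<in> {2..n + 1}. b j \<noteq> 0}"
    arbitrary: a b rule: less_induct)
  case less
  have N0: "Poly_Mapping.lookup N w = 0" if "length w > 2" for w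
    using N[of w] that by (auto simp: in_keys_iff)
  have step_left: ?case if i: "i \<in> {1..n}" "a i \<noteq> 0" and "i = 1 \<longrightarrow> b 2 = 0" for i
  proof -
    \<comment> \<open>Written as a difference so that the update lemma for combinations applies with \<open>c = a i\<close>.\<close>
    let ?a = "a(i := a i - a i)"
    have "{k \<in> {1..n}. ?a k \<noteq> 0} \<subset> {k \<in> {1..n}. a k \<noteq> 0}" using i by auto
    then have "card {k \<in> {1..n}. ?a k \<noteq> 0} < card {k \<in> {1..n}. a k \<noteq> 0}"
      by (intro psubset_card_mono) auto
    then have "red\<^sup>*\<^sup>* (N + combination n G ?a b) N"
      by (intro less) simp
    moreover have "Poly_Mapping.lookup (N + combination n G a b) (i # lead_word n i) = a i"
      using that n by (simp add: lookup_add N0 length_lead_word lookup_combination_left)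
    then have "red (N + combination n G a b) (N + combination n G ?a b)"
      using red_left[of i "N + combination n G a b" "a i"] i
      unfolding combination_update_left[OF i(1)] by (simp add: add_diff_eq)
    ultimately show ?thesis by (rule converse_rtranclp_into_rtranclp[rotated])
  qed
  have step_right: ?case if j: "j \<in> {2..n + 1}" "b j \<noteq> 0" and "j = n + 1 \<longrightarrow> a n = 0" for j
  proof -
    let ?b = "b(j := b j - b j)"
    have "{k \<in> {2..n + 1}. ?b k \<noteq> 0} \<subset> {k \<in> {2..n + 1}. b k \<noteq> 0}" using j by auto
    then have "card {k \<in> {2..n + 1}. ?b k \<noteq> 0} < card {k \<in> {2..n + 1}. b k \<noteq> 0}"
      by (intro psubset_card_mono) auto
    then have "red\<^sup>*\<^sup>* (N + combination n G a ?b) N"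
      by (intro less) simp
    moreover have "Poly_Mapping.lookup (N + combination n G a b) (lead_word n j @ [j]) = b j"
      using that n by (simp add: lookup_add N0 length_lead_word lookup_combination_right)
    then have "red (N + combination n G a b) (N + combination n G a ?b)"
      using red_right[of j "N + combination n G a b" "b j"] j
      unfolding combination_update_right[OF j(1)] by (simp add: add_diff_eq)
    ultimately show ?thesis by (rule converse_rtranclp_into_rtranclp[rotated])
  qed
  consider j where "j \<in> {2..n}" "b j \<noteq> 0"
    | i where "i \<in> {1..n}" "a i \<noteq> 0" "b 2 = 0"
    | "b (n + 1) \<noteq> 0" "a n = 0"
    | "\<forall>i\<in>{1..n}. a i = 0" "\<forall>j\<in>{2..n + 1}. b j = 0"
  proof -
    have "{2..n + 1} = insert (n + 1) {2..n}" "2 \<in> {2..n}" "n \<in> {1..n}" using n by auto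
    then show ?thesis using that by (metis insert_iff)
  qed
  then show ?case
  proof cases
    case (1 j)
    then show ?thesis by (intro step_right[of j]) auto
  next
    case (2 i)
    then show ?thesis by (intro step_left[of i]) auto
  next
    case 3
    then show ?thesis using n by (intro step_right[of "n + 1"]) auto
  next
    case 4
    then have "combination n G a b = 0"
      using combination_cong[of a "\<lambda>_. 0" b "\<lambda>_. 0"] combination_zero by simp
    then show ?thesis by simp
  qed
qed

text \<open>
  Reductions cannot leave the set \<open>N + combination n G a b\<close>. For \<open>n \<ge> 3\<close> the words of \<open>N\<close> and the
  words of degree two in the combination are too short to be reduced, so the reduced word is an
  arrangement of all \<open>n + 1\<close> letters. It is therefore a leading word with its missing letter added
  at one end; it is not the overlap word, whose coefficient vanishes.
\<close>

lemma red_combination: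
  assumes N: "\<And>w. w \<in> Poly_Mapping.keys N \<Longrightarrow> length w = 2" and n3: "n \<ge> 3"
    and red: "red (N + combination n G a b) h"
  shows "\<exists>a' b'. h = N + combination n G a' b'"
proof -
  from red obtain i w1 w2 where i: "i \<in> {1..n + 1}"
    and nz: "Poly_Mapping.lookup (N + combination n G a b) (w1 @ lead_word n i @ w2) \<noteq> 0"
    and h: "h = N + combination n G a b -
      fscale (Poly_Mapping.lookup (N + combination n G a b) (w1 @ lead_word n i @ w2))
        (word w1 * G i * word w2)"
    unfolding red_step_def Let_def using LM_eq by fastforce
  define w where "w = w1 @ lead_word n i @ w2"
  define c where "c = Poly_Mapping.lookup (N + combination n G a b) w"
  have len: "length w \<ge> 3" using n3 length_lead_word[OF i] by (simp add: w_def)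
  then have "Poly_Mapping.lookup N w = 0" using N[of w] by (auto simp: in_keys_iff)
  then have nz': "Poly_Mapping.lookup (combination n G a b) w \<noteq> 0"
    using nz by (simp add: lookup_add w_def)
  then have "mset w = mset [1..<n + 2]" using lookup_combination_support len by blast
  then have "mset (letters_omitting n i) + (mset w1 + mset w2) = mset (letters_omitting n i) + {#i#}"
    unfolding mset_letters_omitting[OF i, symmetric] by (simp add: w_def mset_lead_word ac_simps)
  then have "mset w1 + mset w2 = {#i#}"
    by (rule add_left_imp_eq)
  then consider "w1 = [i]" "w2 = []" | "w1 = []" "w2 = [i]"
    by (auto simp: union_is_single)
  then show ?thesis
  proof cases
    case 1
    have "i \<noteq> n + 1"
    proof
      assume "i = n + 1"
      then have "w = lead_word n 1 @ [1]" using 1 lead_word_overlap[of n] by (simp add: w_def)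
      then show False using nz' lookup_combination_overlap by simp
    qed
    then have "i \<in> {1..n}" using i by auto
    then show ?thesis
      using h 1 combination_update_left[of i n G a c b]
      by (intro exI[of _ "a(i := a i - c)"] exI[of _ b]) (simp add: c_def w_def word_Nil gen_def add_diff_eq)
  next
    case 2
    have "i \<noteq> 1"
    proof
      assume "i = 1"
      then show False using nz' lookup_combination_overlap 2 by (simp add: w_def)
    qed
    then have "i \<in> {2..n + 1}" using i by auto
    then show ?thesis
      using h 2 combination_update_right[of i n G a b c]
      by (intro exI[of _ a] exI[of _ "b(i := b i - c)"]) (simp add: c_def w_def word_Nil gen_def add_diff_eq)
  qed
qed

text \<open>
  A normal form is again \<open>N\<close> plus a combination, and being in normal form forces the coefficients of
  that combination at all leading words of its products to vanish. The triangular system then leaves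
  only the zero combination.
\<close>

lemma normal_form_combination_iff:
  assumes N: "\<And>w. w \<in> Poly_Mapping.keys N \<Longrightarrow> length w = 2" and n3: "n \<ge> 3"
  shows "normal_form_of {1..n + 1} (G ` {1..n + 1}) (N + combination n G a b) h \<longleftrightarrow> h = N"
proof
  assume "h = N"
  moreover have "\<not> sublist (LM (G i)) w" if "i \<in> {1..n + 1}" "w \<in> Poly_Mapping.keys N" for i w
    using sublist_length_le[of "LM (G i)" w] N[OF that(2)] n3 that(1)
    by (auto simp: LM_eq length_lead_word)
  ultimately show "normal_form_of {1..n + 1} (G ` {1..n + 1}) (N + combination n G a b) h"
    using reduce_combination[OF N] by (auto simp: normal_form_of_def in_normal_form_def)
next
  assume nf: "normal_form_of {1..n + 1} (G ` {1..n + 1}) (N + combination n G a b) h"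
  then have "red\<^sup>*\<^sup>* (N + combination n G a b) h" by (simp add: normal_form_of_def)
  then have "\<exists>a' b'. h = N + combination n G a' b'"
    by induction (use red_combination[OF N n3] in blast)+
  then obtain a' b' where h: "h = N + combination n G a' b'" by blast
  have zero: "Poly_Mapping.lookup (combination n G a' b') w = 0"
    if i: "i \<in> {1..n + 1}" and w: "w = i # lead_word n i \<or> w = lead_word n i @ [i]" for i w
  proof -
    have "sublist (LM (G i)) w" using w by (auto simp: LM_eq[OF i] sublist_Cons_right)
    then have "w \<notin> Poly_Mapping.keys h"
      using nf i by (auto simp: normal_form_of_def in_normal_form_def)
    moreover have "w \<notin> Poly_Mapping.keys N"
      using N[of w] w n length_lead_word[OF i] by auto
    ultimately show ?thesis by (simp add: h in_keys_iff lookup_add)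
  qed
  have "combination n G a' b' = 0"
  proof (rule combination_eq_0)
    show "Poly_Mapping.lookup (combination n G a' b') (i # lead_word n i) = 0"
      if "i \<in> {1..n}" for i
      using that by (intro zero[of i]) auto
    show "Poly_Mapping.lookup (combination n G a' b') (lead_word n j @ [j]) = 0"
      if "j \<in> {2..n + 1}" for j
      using that by (intro zero[of j]) auto
  qed
  then show "h = N" using h by simp
qed

end

section \<open>The composition\<close>

lemma fscale_minus_one_power: "fscale ((-1) ^ k) f = (-1) ^ k * f"
  by (rule poly_mapping_eqI) (simp add: lookup_fscale lookup_minus_one_power_mult)

lemma linear_image_homogeneous:
  assumes "Vector_Spaces.linear scale fscale \<phi>"
    and "\<And>b. b \<in> B \<Longrightarrow> \<forall>w\<in>Poly_Mapping.keys (\<phi> b). length w = d"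
    and "v \<in> module.span scale B"
  shows "\<forall>w\<in>Poly_Mapping.keys (\<phi> v). length w = d"
proof -
  interpret Vector_Spaces.linear scale fscale \<phi> by fact
  let ?S = "{v. \<forall>w. length w \<noteq> d \<longrightarrow> Poly_Mapping.lookup (\<phi> v) w = 0}"
  have "vs1.subspace ?S"
    by (intro vs1.subspaceI) (simp_all add: zero add scale lookup_add lookup_fscale)
  moreover have "B \<subseteq> ?S"
  proof
    fix b assume "b \<in> B"
    from assms(2)[OF this] show "b \<in> ?S" by (auto simp: in_keys_iff)
  qed
  ultimately have "vs1.span B \<subseteq> ?S" by (intro vs1.span_minimal)
  with assms(3) show ?thesis by (auto simp: in_keys_iff)
qed

theorem theorem3p8:
  fixes scale :: "'a::{alg_closed_field, field_char_0} \<Rightarrow> 'v::ab_group_add \<Rightarrow> 'v"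
    and n :: nat and br :: "'v list \<Rightarrow> 'v" and e :: "nat \<Rightarrow> 'v"
    and \<phi> :: "'v \<Rightarrow> 'a free_algebra"
    and x y G :: "nat \<Rightarrow> 'a free_algebra" and N :: "'a free_algebra"
  assumes "n \<ge> 2"
    and "alternating_algebra scale n br"
    and "inj_on e {1..n + 1}"
    and "\<not> module.dependent scale (e ` {1..n + 1})"
    and "module.span scale (e ` {1..n + 1}) = UNIV"
    and "\<And>i. x i = gen i"
    and "Vector_Spaces.linear scale fscale \<phi>"
    and "\<And>i. i \<in> {1..n + 1} \<Longrightarrow> \<phi> (e i) = x i"
    and "\<And>i. y i = \<phi> (br (omit n e i))"
    and "\<And>i. G i = (-1) ^ (n div 2) * (alt (omit n x i) - y i)"
    and "N = (-1) ^ n * (\<Sum>i = 1..n + 1. (-1) ^ i * (x i * G i - (-1) ^ n * (G i * x i)))"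
  shows "(red_step {1..n + 1} (G ` {1..n + 1}))\<^sup>*\<^sup>* (G 1 * x 1 - x (n + 1) * G (n + 1)) N
    \<and> (n \<ge> 3 \<longrightarrow>
        (\<forall>h. normal_form_of {1..n + 1} (G ` {1..n + 1}) (G 1 * x 1 - x (n + 1) * G (n + 1)) h
          \<longleftrightarrow> h = N))
    \<and> N = (-1) ^ (n div 2) *
        ((-1) ^ (n + 1) * (\<Sum>i = 1..n + 1. (-1) ^ i * (x i * y i - (-1) ^ n * (y i * x i))))"
proof -
  note n = assms(1) and N_def = assms(11)
  have x: "x = gen" using assms(6) by (rule ext)
  have G: "G i = (-1) ^ (n div 2) * (alt (omit n gen i) - y i)" for i
    using assms(10) x by simp
  have y: "length w = 1" if "w \<in> Poly_Mapping.keys (y i)" for i w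
  proof -
    have "\<forall>w\<in>Poly_Mapping.keys (\<phi> (br (omit n e i))). length w = 1"
    proof (rule linear_image_homogeneous[OF assms(7)])
      show "br (omit n e i) \<in> module.span scale (e ` {1..n + 1})" by (simp only: assms(5) UNIV_I)
      show "\<forall>w\<in>Poly_Mapping.keys (\<phi> b). length w = 1" if "b \<in> e ` {1..n + 1}" for b
        using that assms(8) by (auto simp: x gen_def word_def)
    qed
    then show ?thesis using that assms(9) by simp
  qed
  have y0: "Poly_Mapping.lookup (y i) w = 0" if "length w \<noteq> 1" for i w
    using y[of w i] that by (auto simp: in_keys_iff)
  \<comment> \<open>The alternating parts cancel by the two expansions, so \<open>N\<close> has only words of length two.\<close>
  have N_y: "N = (-1) ^ (n div 2) *
      ((-1) ^ (n + 1) * (\<Sum>i = 1..n + 1. (-1) ^ i * (x i * y i - (-1) ^ n * (y i * x i))))"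
  proof -
    let ?s = "(-1) ^ (n div 2) :: 'a free_algebra"
    have "(-1) ^ i * (gen i * G i - (-1) ^ n * (G i * gen i)) =
        ?s * ((-1) ^ i * (gen i * alt (omit n gen i) - (-1) ^ n * (alt (omit n gen i) * gen i)) -
              (-1) ^ i * (gen i * y i - (-1) ^ n * (y i * gen i)))" for i
      by (simp add: G minus_one_power_iff algebra_simps)
    then have "(\<Sum>i = 1..n + 1. (-1) ^ i * (gen i * G i - (-1) ^ n * (G i * gen i))) =
        - (?s * (\<Sum>i = 1..n + 1. (-1) ^ i * (gen i * y i - (-1) ^ n * (y i * gen i))))"
      by (simp only: sum_distrib_left[symmetric] sum_subtractf alternating_expansions_agree)
        (simp del: sum.cl_ivl_Suc)
    then show ?thesis unfolding N_def x by (simp add: minus_one_power_iff)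
  qed
  have N: "length w = 2" if "w \<in> Poly_Mapping.keys N" for w
  proof (rule ccontr)
    assume w: "length w \<noteq> 2"
    then have "length (tl w) \<noteq> 1" "length (butlast w) \<noteq> 1" by auto
    then have "Poly_Mapping.lookup (gen i * y i) w = 0" "Poly_Mapping.lookup (y i * gen i) w = 0" for i
      by (simp_all add: lookup_gen_mult lookup_mult_gen y0)
    then have "Poly_Mapping.lookup N w = 0"
      unfolding N_y x lookup_minus_one_power_mult lookup_sum lookup_minus by simp
    with that show False by (simp add: in_keys_iff)
  qed
  interpret rewriting_system n G
  proof
    show "n \<ge> 2" by fact
    show "Poly_Mapping.lookup (G i) (lead_word n i) = 1" if "i \<in> {1..n + 1}" for i
      using n length_lead_word[OF that] lookup_alt_omit_lead_word[OF that, where 'a = 'a]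
      by (simp add: G lookup_minus_one_power_mult lookup_minus y0 flip: power_add mult_2)
    show "mset w = mset (letters_omitting n i) \<or> length w = 1"
      if "w \<in> Poly_Mapping.keys (G i)" for i w
    proof (rule ccontr)
      assume "\<not> ?thesis"
      then have "Poly_Mapping.lookup (G i) w = 0"
        by (simp add: G lookup_minus_one_power_mult lookup_minus y0 lookup_alt_omit)
      with that show False by (simp add: in_keys_iff)
    qed
  qed
  \<comment> \<open>The products in \<open>N\<close> other than \<open>G 1 * x 1\<close> and \<open>x (n + 1) * G (n + 1)\<close>, with opposite signs.\<close>
  let ?a = "\<lambda>i. (-1) ^ (n + i + 1) :: 'a" and ?b = "\<lambda>j. (-1) ^ j :: 'a"
  have start: "G 1 * x 1 - x (n + 1) * G (n + 1) = N + combination n G ?a ?b"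
  proof -
    let ?L = "\<lambda>i. (-1) ^ i * (gen i * G i)" and ?R = "\<lambda>i. (-1) ^ i * (G i * gen i)"
    have "N = (-1) ^ n * (\<Sum>i = 1..n + 1. ?L i) - (\<Sum>i = 1..n + 1. ?R i)"
      unfolding N_def x
      by (simp add: right_diff_distrib sum_subtractf sum_distrib_left minus_one_power_iff
          del: sum.cl_ivl_Suc)
    moreover have "(\<Sum>i = 1..n + 1. ?L i) = (\<Sum>i = 1..n. ?L i) + ?L (n + 1)"
      by simp
    moreover have "(\<Sum>i = 1..n + 1. ?R i) = ?R 1 + (\<Sum>i = 2..n + 1. ?R i)"
      by (subst sum.atLeast_Suc_atMost) (simp_all add: numeral_2_eq_2 del: sum.cl_ivl_Suc)
    moreover have "combination n G ?a ?b =
        - ((-1) ^ n * (\<Sum>i = 1..n. ?L i)) + (\<Sum>i = 2..n + 1. ?R i)"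
      unfolding combination_def fscale_minus_one_power sum_distrib_left sum_negf[symmetric]
      by (intro arg_cong2[of _ _ _ _ "(+)"] sum.cong refl) (simp add: minus_one_power_iff)
    moreover have "(-1) ^ n * ?L (n + 1) = - (gen (n + 1) * G (n + 1))"
      by (simp add: minus_one_power_iff)
    ultimately show ?thesis by (simp add: x distrib_left right_diff_distrib del: sum.cl_ivl_Suc)
  qed
  show ?thesis
    unfolding start using reduce_combination[OF N] normal_form_combination_iff[OF N] N_y by blast
qed

end
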